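(* Let $\pi$ be a commutative semigroup and let $(\{A_\varphi\}_{\varphi\in\pi},\{[,]_{p,q}\}_{p,q\in\pi},\{R_\varphi\}_{\varphi\in\pi})$ be a Rota-Baxter Lie T-algebra of weight $0$. Then $(\{A_\varphi\}_{\varphi\in\pi},\{\ast_{p,q}\}_{p,q\in\pi})$ is a pre-Lie T-algebra, where $$a\ast_{p,q}b=[R_p(a),b]_{p,q}$$ for $a\in A_p$, $b\in A_q$ and $p,q\in\pi$.
   Context: $K$ is a field; all vector spaces, tensor products and linear maps are over $K$. Let $\pi$ be a commutative semigroup. A Lie T-algebra is a family of vector spaces $\{A_\varphi\}_{\varphi\in\pi}$ with bilinear operations $[,]_{p,q}:A_p\otimes A_q\to A_{pq}$ such that $[a,b]_{p,q}+[b,a]_{q,p}=0$ and $[[a,b]_{p,q},c]_{pq,t}+[[b,c]_{q,t},a]_{qt,p}+[[c,a]_{t,p},b]_{tp,q}=0$ for all $p,q,t\in\pi$, $a\in A_p,b\in A_q,c\in A_t$. A Rota-Baxter Lie T-algebra of weight $\lambda\in K$ is a Lie T-algebra with linear maps $\{R_\varphi:A_\varphi\to A_\varphi\}_{\varphi\in\pi}$ such that $[R_p(a),R_q(b)]_{p,q}=R_{pq}([a,R_q(b)]_{p,q})+R_{pq}([R_p(a),b]_{p,q})+\lambda R_{pq}([a,b]_{p,q})$ for all $p,q\in\pi$, $a\in A_p$, $b\in A_q$. A pre-Lie T-algebra is a family of vector spaces $\{A_\varphi\}_{\varphi\in\pi}$ with bilinear operations $\ast_{p,q}:A_p\otimes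 A_q\to A_{pq}$ such that $a\ast_{p,qt}(b\ast_{q,t}c)-(a\ast_{p,q}b)\ast_{pq,t}c=b\ast_{q,pt}(a\ast_{p,t}c)-(b\ast_{q,p}a)\ast_{qp,t}c$ for all $p,q,t\in\pi$, $a\in A_p,b\in A_q,c\in A_t$. *)

theory Defs
  imports "HOL-Algebra.Module"
begin

text \<open>
  Vector spaces over the field \<open>K\<close> are the \<open>K\<close>-modules of HOL-Algebra.  A family of vector
  spaces is a function \<open>A\<close> on the index semigroup whose values are modules with
  possibly different carriers and operations.  The carriers lie in one common type, which is
  no restriction, since one can pass to the disjoint union.  Maps are constrained only on carriers.
\<close>

definition linear_map ::
    "('k, 'a) ring_scheme \<Rightarrow> ('k, 'v, 'b) module_scheme \<Rightarrow> ('k, 'w, 'c) module_scheme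
      \<Rightarrow> ('v \<Rightarrow> 'w) \<Rightarrow> bool" where
  "linear_map K V W f \<longleftrightarrow>
     f \<in> carrier V \<rightarrow> carrier W \<and>
     (\<forall>x\<in>carrier V. \<forall>y\<in>carrier V. f (x \<oplus>\<^bsub>V\<^esub> y) = f x \<oplus>\<^bsub>W\<^esub> f y) \<and>
     (\<forall>k\<in>carrier K. \<forall>x\<in>carrier V. f (k \<odot>\<^bsub>V\<^esub> x) = k \<odot>\<^bsub>W\<^esub> f x)"

text \<open>Linear maps \<open>U \<otimes> V \<rightarrow> W\<close> are rendered as bilinear maps.\<close>

definition bilinear_map ::
    "('k, 'a) ring_scheme \<Rightarrow> ('k, 'u, 'b) module_scheme \<Rightarrow> ('k, 'v, 'c) module_scheme
      \<Rightarrow> ('k, 'w, 'd) module_scheme \<Rightarrow> ('u \<Rightarrow> 'v \<Rightarrow> 'w) \<Rightarrow> bool" where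
  "bilinear_map K U V W f \<longleftrightarrow>
     (\<forall>x\<in>carrier U. linear_map K V W (f x)) \<and>
     (\<forall>y\<in>carrier V. linear_map K U W (\<lambda>x. f x y))"

locale bilinear_family = field K
  for K :: "('k, 'm) ring_scheme" (structure) +
  fixes A :: "'p::ab_semigroup_mult \<Rightarrow> ('k, 'v, 'n) module_scheme"
    and m :: "'p \<Rightarrow> 'p \<Rightarrow> 'v \<Rightarrow> 'v \<Rightarrow> 'v"
  assumes vector_space: "Module.module K (A p)"
    and bilinear: "bilinear_map K (A p) (A q) (A (p * q)) (m p q)"

locale Lie_T_algebra = bilinear_family K A br
  for K :: "('k, 'm) ring_scheme" (structure)
    and A :: "'p::ab_semigroup_mult \<Rightarrow> ('k, 'v, 'n) module_scheme"
    and br :: "'p \<Rightarrow> 'p \<Rightarrow> 'v \<Rightarrow> 'v \<Rightarrow> 'v" +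
  assumes antisymmetry:
    "\<lbrakk>a \<in> carrier (A p); b \<in> carrier (A q)\<rbrakk>
      \<Longrightarrow> br p q a b \<oplus>\<^bsub>A (p * q)\<^esub> br q p b a = \<zero>\<^bsub>A (p * q)\<^esub>"
    and Jacobi:
    "\<lbrakk>a \<in> carrier (A p); b \<in> carrier (A q); c \<in> carrier (A t)\<rbrakk>
      \<Longrightarrow> br (p * q) t (br p q a b) c
            \<oplus>\<^bsub>A (p * q * t)\<^esub> br (q * t) p (br q t b c) a
            \<oplus>\<^bsub>A (p * q * t)\<^esub> br (t * p) q (br t p c a) b
          = \<zero>\<^bsub>A (p * q * t)\<^esub>"

locale Rota_Baxter_Lie_T_algebra = Lie_T_algebra K A br
  for K :: "('k, 'm) ring_scheme" (structure)
    and A :: "'p::ab_semigroup_mult \<Rightarrow> ('k, 'v, 'n) module_scheme"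
    and br :: "'p \<Rightarrow> 'p \<Rightarrow> 'v \<Rightarrow> 'v \<Rightarrow> 'v" +
  fixes R :: "'p \<Rightarrow> 'v \<Rightarrow> 'v"
    and weight :: 'k
  assumes weight_closed: "weight \<in> carrier K"
    and R_linear: "linear_map K (A p) (A p) (R p)"
    and Rota_Baxter:
    "\<lbrakk>a \<in> carrier (A p); b \<in> carrier (A q)\<rbrakk>
      \<Longrightarrow> br p q (R p a) (R q b)
          = R (p * q) (br p q a (R q b))
            \<oplus>\<^bsub>A (p * q)\<^esub> R (p * q) (br p q (R p a) b)
            \<oplus>\<^bsub>A (p * q)\<^esub> weight \<odot>\<^bsub>A (p * q)\<^esub> R (p * q) (br p q a b)"

locale pre_Lie_T_algebra = bilinear_family K A star
  for K :: "('k, 'm) ring_scheme" (structure)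
    and A :: "'p::ab_semigroup_mult \<Rightarrow> ('k, 'v, 'n) module_scheme"
    and star :: "'p \<Rightarrow> 'p \<Rightarrow> 'v \<Rightarrow> 'v \<Rightarrow> 'v" +
  assumes pre_Lie:
    "\<lbrakk>a \<in> carrier (A p); b \<in> carrier (A q); c \<in> carrier (A t)\<rbrakk>
      \<Longrightarrow> star p (q * t) a (star q t b c) \<ominus>\<^bsub>A (p * q * t)\<^esub> star (p * q) t (star p q a b) c
          = star q (p * t) b (star p t a c) \<ominus>\<^bsub>A (p * q * t)\<^esub> star (q * p) t (star q p b a) c"

end

theory Submission
  imports Defs
begin

text \<open>
  By the Jacobi identity \<open>a * (b * c) - b * (a * c) = [[R a, R b], c]\<close>.  In weight \<open>0\<close>, the
  Rota-Baxter identity and antisymmetry give \<open>[R a, R b] = R (a * b) - R (b * a)\<close>, so the right-hand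
  side is \<open>(a * b) * c - (b * a) * c\<close>.
\<close>

context bilinear_family
begin

lemma abelian_group_component: "abelian_group (A p)"
  using vector_space[of p] by (simp add: module_def)

lemma mult_closed:
  "\<lbrakk>a \<in> carrier (A p); b \<in> carrier (A q)\<rbrakk> \<Longrightarrow> m p q a b \<in> carrier (A (p * q))"
  using bilinear[of p q] by (auto simp: bilinear_map_def linear_map_def)

lemma mult_add_left:
  "\<lbrakk>a \<in> carrier (A p); a' \<in> carrier (A p); b \<in> carrier (A q)\<rbrakk>
    \<Longrightarrow> m p q (a \<oplus>\<^bsub>A p\<^esub> a') b = m p q a b \<oplus>\<^bsub>A (p * q)\<^esub> m p q a' b"
  using bilinear[of p q] by (auto simp: bilinear_map_def linear_map_def)

end

text \<open>Cancelling in \<open>f 0 + f 0 = f 0\<close> gives \<open>f 0 = 0\<close>, so the image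
  of \<open>- x\<close> is an additive inverse of \<open>f x\<close>. Only additivity enters the
  argument, so one lemma serves both a bracket in its left argument and the operators
  \<open>R p\<close>.\<close>

lemma additive_uminus:
  assumes "abelian_group V" "abelian_group W" "f \<in> carrier V \<rightarrow> carrier W"
    and add: "\<And>x y. \<lbrakk>x \<in> carrier V; y \<in> carrier V\<rbrakk> \<Longrightarrow> f (x \<oplus>\<^bsub>V\<^esub> y) = f x \<oplus>\<^bsub>W\<^esub> f y"
    and x: "x \<in> carrier V"
  shows "f (\<ominus>\<^bsub>V\<^esub> x) = \<ominus>\<^bsub>W\<^esub> f x"
proof -
  interpret V: abelian_group V by fact
  interpret W: abelian_group W by fact
  have cl: "f y \<in> carrier W" if "y \<in> carrier V" for y
    using assms(3) that by blast
  have "f \<zero>\<^bsub>V\<^esub> \<oplus>\<^bsub>W\<^esub> f \<zero>\<^bsub>V\<^esub> = f \<zero>\<^bsub>V\<^esub>"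
    using add[of "\<zero>\<^bsub>V\<^esub>" "\<zero>\<^bsub>V\<^esub>"] by simp
  then have zero: "f \<zero>\<^bsub>V\<^esub> = \<zero>\<^bsub>W\<^esub>"
    using cl[of "\<zero>\<^bsub>V\<^esub>"] W.add.l_cancel_one' by auto
  have "f (\<ominus>\<^bsub>V\<^esub> x) \<oplus>\<^bsub>W\<^esub> f x = \<zero>\<^bsub>W\<^esub>"
    using add[of "\<ominus>\<^bsub>V\<^esub> x" x] x zero by (simp add: V.l_neg)
  then show ?thesis
    using cl x by (metis V.a_inv_closed W.minus_equality)
qed

context bilinear_family
begin

lemma mult_uminus_left:
  assumes "a \<in> carrier (A p)" "b \<in> carrier (A q)"
  shows "m p q (\<ominus>\<^bsub>A p\<^esub> a) b = \<ominus>\<^bsub>A (p * q)\<^esub> m p q a b"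
  by (rule additive_uminus[where f = "\<lambda>x. m p q x b"])
    (use assms in \<open>auto simp: abelian_group_component mult_closed mult_add_left\<close>)

end

context Lie_T_algebra
begin

text \<open>Commutativity of the index semigroup puts both brackets into the same component, where
  antisymmetry makes one the additive inverse of the other.\<close>

lemma bracket_swap:
  assumes "a \<in> carrier (A p)" "b \<in> carrier (A q)"
  shows "br p q a b = \<ominus>\<^bsub>A (p * q)\<^esub> br q p b a"
proof -
  interpret abelian_group "A (p * q)" by (rule abelian_group_component)
  show ?thesis
    using minus_equality[OF antisymmetry[OF assms]] mult_closed[OF assms]
      mult_closed[OF assms(2,1)] by (simp add: mult.commute)
qed

text \<open>This is the Jacobi identity solved for its first summand. One swap turns
  \<open>[[b, c], a]\<close> into \<open>- [a, [b, c]]\<close>; two swaps turn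
  \<open>[[c, a], b]\<close> into \<open>[b, [a, c]]\<close>.\<close>

lemma Leibniz:
  assumes a: "a \<in> carrier (A p)" and b: "b \<in> carrier (A q)" and c: "c \<in> carrier (A t)"
  shows "br (p * q) t (br p q a b) c
    = br p (q * t) a (br q t b c) \<ominus>\<^bsub>A (p * q * t)\<^esub> br q (p * t) b (br p t a c)"
proof -
  interpret W: abelian_group "A (p * q * t)" by (rule abelian_group_component)
  let ?X = "br p (q * t) a (br q t b c)" and ?Y = "br q (p * t) b (br p t a c)"
    and ?Z = "br (p * q) t (br p q a b) c"
  have bc: "br q t b c \<in> carrier (A (q * t))" and ac: "br p t a c \<in> carrier (A (p * t))"
    using assms by (auto intro: mult_closed)
  \<comment> \<open>The terms arise in components indexed by differently ordered products; these
    equations bring them all into \<open>A (p * q * t)\<close>.\<close>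
  have eqs: "p * (q * t) = p * q * t" "q * t * p = p * q * t" "q * (p * t) = p * q * t"
    "p * t * q = p * q * t" "t * p = p * t"
    by (simp_all add: ac_simps)
  have X: "?X \<in> carrier (A (p * q * t))" and Y: "?Y \<in> carrier (A (p * q * t))"
    and Z: "?Z \<in> carrier (A (p * q * t))"
    using mult_closed[OF a bc] mult_closed[OF b ac] mult_closed[OF mult_closed[OF a b] c]
    by (simp_all add: eqs)
  have "br (q * t) p (br q t b c) a = \<ominus>\<^bsub>A (p * q * t)\<^esub> ?X"
    using bracket_swap[OF bc a] by (simp add: eqs)
  moreover have "br (t * p) q (br t p c a) b = ?Y"
  proof -
    have "br t p c a = \<ominus>\<^bsub>A (p * t)\<^esub> br p t a c"
      using bracket_swap[OF c a] by (simp add: eqs)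
    \<comment> \<open>Linearity in the left argument pulls out the sign of the inner swap; the outer
      swap then cancels it.\<close>
    then have "br (t * p) q (br t p c a) b = \<ominus>\<^bsub>A (p * q * t)\<^esub> br (p * t) q (br p t a c) b"
      using mult_uminus_left[OF ac b] by (simp add: eqs)
    also have "\<dots> = ?Y"
      using bracket_swap[OF ac b] Y by (simp add: eqs)
    finally show ?thesis .
  qed
  ultimately have "?Z \<oplus>\<^bsub>A (p * q * t)\<^esub> (\<ominus>\<^bsub>A (p * q * t)\<^esub> ?X \<oplus>\<^bsub>A (p * q * t)\<^esub> ?Y)
      = \<zero>\<^bsub>A (p * q * t)\<^esub>"
    using Jacobi[OF assms] X Y Z by (simp add: W.a_assoc)
  then have "?Z = \<ominus>\<^bsub>A (p * q * t)\<^esub> (\<ominus>\<^bsub>A (p * q * t)\<^esub> ?X \<oplus>\<^bsub>A (p * q * t)\<^esub> ?Y)"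
    using W.minus_equality X Y Z by (metis W.a_inv_closed W.add.m_closed)
  then show ?thesis
    using X Y by (simp add: W.minus_add W.minus_eq)
qed

end

theorem proposition4p13:
  fixes K :: "('k, 'm) ring_scheme"
    and A :: "'p::ab_semigroup_mult \<Rightarrow> ('k, 'v, 'n) module_scheme"
    and br :: "'p \<Rightarrow> 'p \<Rightarrow> 'v \<Rightarrow> 'v \<Rightarrow> 'v"
    and R :: "'p \<Rightarrow> 'v \<Rightarrow> 'v"
  assumes "Rota_Baxter_Lie_T_algebra K A br R \<zero>\<^bsub>K\<^esub>"
  shows "pre_Lie_T_algebra K A (\<lambda>p q a b. br p q (R p a) b)"
proof -
  interpret Rota_Baxter_Lie_T_algebra K A br R "\<zero>\<^bsub>K\<^esub>" by fact
  have R_closed: "R p a \<in> carrier (A p)" if "a \<in> carrier (A p)" for p a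
    using R_linear[of p] that by (auto simp: linear_map_def)
  have R_uminus: "R p (\<ominus>\<^bsub>A p\<^esub> a) = \<ominus>\<^bsub>A p\<^esub> R p a" if "a \<in> carrier (A p)" for p a
    using R_linear[of p] that
    by (intro additive_uminus[where f = "R p"]) (auto simp: abelian_group_component linear_map_def)
  show ?thesis
  proof (intro pre_Lie_T_algebra.intro bilinear_family.intro bilinear_family_axioms.intro
      pre_Lie_T_algebra_axioms.intro)
    show "field K" by (rule field_axioms)
    show "Module.module K (A p)" for p by (rule vector_space)
    \<comment> \<open>Precomposing the left argument with the linear map \<open>R p\<close> keeps
      the bracket bilinear.\<close>
    show "bilinear_map K (A p) (A q) (A (p * q)) (\<lambda>a b. br p q (R p a) b)" for p q
      using bilinear[of p q] R_linear[of p]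
      by (auto simp: bilinear_map_def linear_map_def Pi_iff)
  next
    fix a b c p q t
    assume a: "a \<in> carrier (A p)" and b: "b \<in> carrier (A q)" and c: "c \<in> carrier (A t)"
    interpret V: abelian_group "A (p * q)" by (rule abelian_group_component)
    interpret W: abelian_group "A (p * q * t)" by (rule abelian_group_component)
    note Ra = R_closed[OF a] and Rb = R_closed[OF b]
    \<comment> \<open>For the new product, \<open>?u\<close> is R(a * b) and \<open>?v\<close> is
      R(b * a). The latter is written with index \<open>p * q\<close> instead of
      \<open>q * p\<close> so that both visibly lie in one component.\<close>
    let ?u = "R (p * q) (br p q (R p a) b)" and ?v = "R (p * q) (br q p (R q b) a)"
    let ?X = "br p (q * t) (R p a) (br q t (R q b) c)"
      and ?Y = "br q (p * t) (R q b) (br p t (R p a) c)"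
    have qp: "q * p = p * q" by (simp add: mult.commute)
    have ab: "br p q (R p a) b \<in> carrier (A (p * q))"
      and ba: "br q p (R q b) a \<in> carrier (A (p * q))"
      and ab0: "br p q a b \<in> carrier (A (p * q))"
      using mult_closed[OF Ra b] mult_closed[OF Rb a] mult_closed[OF a b] by (simp_all add: qp)
    note u = R_closed[OF ab] and v = R_closed[OF ba]
    \<comment> \<open>The weight term is a zero scalar multiple and vanishes.\<close>
    have "br p q (R p a) (R q b) = R (p * q) (br p q a (R q b)) \<oplus>\<^bsub>A (p * q)\<^esub> ?u"
      using Rota_Baxter[OF a b] module.smult_l_null[OF vector_space R_closed[OF ab0]]
        R_closed[OF mult_closed[OF a Rb]] u by simp
    \<comment> \<open>The swap turns the bracket inside the remaining Rota-Baxter term into the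
      negative of b * a.\<close>
    also have "br p q a (R q b) = \<ominus>\<^bsub>A (p * q)\<^esub> br q p (R q b) a"
      by (rule bracket_swap[OF a Rb])
    finally have RR: "br p q (R p a) (R q b) = \<ominus>\<^bsub>A (p * q)\<^esub> ?v \<oplus>\<^bsub>A (p * q)\<^esub> ?u"
      by (simp add: R_uminus[OF ba])
    let ?U = "br (p * q) t ?u c" and ?V = "br (p * q) t ?v c"
    have U: "?U \<in> carrier (A (p * q * t))" and V: "?V \<in> carrier (A (p * q * t))"
      using mult_closed[OF u c] mult_closed[OF v c] .
    have X: "?X \<in> carrier (A (p * q * t))" and Y: "?Y \<in> carrier (A (p * q * t))"
      using mult_closed[OF Ra mult_closed[OF Rb c]] mult_closed[OF Rb mult_closed[OF Ra c]]
      by (simp_all add: ac_simps)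
    \<comment> \<open>Both sides equal \<open>[[R a, R b], c]\<close>: the left by expanding the
      inner bracket with \<open>RR\<close>, the right by \<open>Leibniz\<close> applied to
      \<open>R p a\<close>, \<open>R q b\<close> and \<open>c\<close>.\<close>
    have "\<ominus>\<^bsub>A (p * q * t)\<^esub> ?V \<oplus>\<^bsub>A (p * q * t)\<^esub> ?U = ?X \<ominus>\<^bsub>A (p * q * t)\<^esub> ?Y"
      using Leibniz[OF Ra Rb c] mult_add_left[OF V.a_inv_closed[OF v] u c]
        mult_uminus_left[OF v c] by (simp add: RR)
    then have "?X = (\<ominus>\<^bsub>A (p * q * t)\<^esub> ?V \<oplus>\<^bsub>A (p * q * t)\<^esub> ?U) \<oplus>\<^bsub>A (p * q * t)\<^esub> ?Y"
      using X Y by (simp add: W.minus_eq W.a_assoc W.l_neg)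
    then have "?X \<ominus>\<^bsub>A (p * q * t)\<^esub> ?U = ?Y \<ominus>\<^bsub>A (p * q * t)\<^esub> ?V"
      using U V Y by (simp add: W.minus_eq W.a_ac W.r_neg W.r_neg1 W.r_neg2)
    \<comment> \<open>Only the index \<open>q * p\<close> demanded by the pre-Lie identity has to be
      restored.\<close>
    then show "?X \<ominus>\<^bsub>A (p * q * t)\<^esub> br (p * q) t ?u c
        = ?Y \<ominus>\<^bsub>A (p * q * t)\<^esub> br (q * p) t (R (q * p) (br q p (R q b) a)) c"
      by (simp add: qp)
  qed
qed

end
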